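(* There exist two compact semialgebraic metric spaces $(X,d_X)$ and $(Y,d_Y)$ over the field $\mathbb{R}$ of real numbers which are isometric but not semialgebraically isometric; that is, there is an isometry from $(X,d_X)$ onto $(Y,d_Y)$, but there is no isometry from $(X,d_X)$ onto $(Y,d_Y)$ whose graph is a semialgebraic set.
   Context: A semialgebraic metric space over $\mathbb{R}$ is a semialgebraic set $X\subset\mathbb{R}^n$ together with a metric $d:X\times X\to\mathbb{R}$ which is a semialgebraic function (its graph is a semialgebraic set) and is continuous with respect to the Euclidean topology on $X$. It is compact if $X$ is bounded and closed in $\mathbb{R}^n$. An isometry is a bijective distance-preserving map. *)

theory Defs
  imports "HOL-Analysis.Analysis"
begin

text \<open>
  The space \<open>\<real>\<^sup>n\<close> is \<^term>\<open>topspace (Euclidean_space n)\<close>: sequences of reals that vanish from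
  index \<open>n\<close> on. This allows the dimension to be bound by a quantifier.
\<close>

text \<open>Polynomial functions in the variables \<open>x 0, \<dots>, x (n - 1)\<close>; over the infinite field
  \<open>\<real>\<close> these are the same as polynomials.\<close>

inductive polynomial_fun :: "nat \<Rightarrow> ((nat \<Rightarrow> real) \<Rightarrow> real) \<Rightarrow> bool" for n where
  const: "polynomial_fun n (\<lambda>x. c)"
| coord: "i < n \<Longrightarrow> polynomial_fun n (\<lambda>x. x i)"
| add: "polynomial_fun n f \<Longrightarrow> polynomial_fun n g \<Longrightarrow> polynomial_fun n (\<lambda>x. f x + g x)"
| mult: "polynomial_fun n f \<Longrightarrow> polynomial_fun n g \<Longrightarrow> polynomial_fun n (\<lambda>x. f x * g x)"

text \<open>The smallest Boolean algebra of subsets of \<open>\<real>\<^sup>n\<close> containing all sets \<open>{f > 0}\<close>; the sets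
  \<open>{f = 0}\<close> are then included as complements of \<open>{f > 0} \<union> {-f > 0}\<close>.\<close>

inductive semialgebraic :: "nat \<Rightarrow> (nat \<Rightarrow> real) set \<Rightarrow> bool" for n where
  pos: "polynomial_fun n f \<Longrightarrow> semialgebraic n {x \<in> topspace (Euclidean_space n). f x > 0}"
| compl: "semialgebraic n S \<Longrightarrow> semialgebraic n (topspace (Euclidean_space n) - S)"
| union: "semialgebraic n S \<Longrightarrow> semialgebraic n T \<Longrightarrow> semialgebraic n (S \<union> T)"

lemma semialgebraic_subset: "semialgebraic n S \<Longrightarrow> S \<subseteq> topspace (Euclidean_space n)"
  by (induction rule: semialgebraic.induct) auto

text \<open>The identification \<open>\<real>\<^sup>n \<times> \<real>\<^sup>m = \<real>\<^bsup>n+m\<^esup>\<close>, and \<open>\<real> = \<real>\<^sup>1\<close>.\<close>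

definition vec_append :: "nat \<Rightarrow> (nat \<Rightarrow> real) \<Rightarrow> (nat \<Rightarrow> real) \<Rightarrow> (nat \<Rightarrow> real)" where
  "vec_append n x y = (\<lambda>i. if i < n then x i else y (i - n))"

definition vec1 :: "real \<Rightarrow> (nat \<Rightarrow> real)" where
  "vec1 t = (\<lambda>i. if i = 0 then t else 0)"

lemma vec_append_in_Euclidean_space:
  assumes "y \<in> topspace (Euclidean_space m)"
  shows "vec_append n x y \<in> topspace (Euclidean_space (n + m))"
  using assms by (auto simp: vec_append_def topspace_Euclidean_space)

lemma vec1_in_Euclidean_space: "vec1 t \<in> topspace (Euclidean_space 1)"
  by (auto simp: vec1_def topspace_Euclidean_space)

definition semialgebraic_map ::
    "nat \<Rightarrow> nat \<Rightarrow> (nat \<Rightarrow> real) set \<Rightarrow> ((nat \<Rightarrow> real) \<Rightarrow> (nat \<Rightarrow> real)) \<Rightarrow> bool" where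
  "semialgebraic_map n m X f \<longleftrightarrow> semialgebraic (n + m) {vec_append n x (f x) | x. x \<in> X}"

text \<open>The locale predicate \<^const>\<open>Metric_space\<close> asks for nonnegativity and symmetry of \<open>d\<close> also
  outside \<open>X\<close>. This is no restriction, as a metric on \<open>X\<close> can be extended by \<open>0\<close>; all other
  conditions only involve the values of \<open>d\<close> on \<open>X \<times> X\<close>.\<close>

definition semialgebraic_metric_space ::
    "nat \<Rightarrow> (nat \<Rightarrow> real) set \<Rightarrow> ((nat \<Rightarrow> real) \<Rightarrow> (nat \<Rightarrow> real) \<Rightarrow> real) \<Rightarrow> bool" where
  "semialgebraic_metric_space n X d \<longleftrightarrow>
     semialgebraic n X \<and>
     Metric_space X d \<and>
     semialgebraic (n + (n + 1))
       {vec_append n x (vec_append n y (vec1 (d x y))) | x y. x \<in> X \<and> y \<in> X} \<and>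
     continuous_map
       (prod_topology (subtopology (Euclidean_space n) X) (subtopology (Euclidean_space n) X))
       euclideanreal (\<lambda>(x, y). d x y)"

text \<open>\<^term>\<open>L2_set x {..<n}\<close> is the Euclidean norm of \<open>x\<close>.\<close>

definition compact_semialgebraic_metric_space ::
    "nat \<Rightarrow> (nat \<Rightarrow> real) set \<Rightarrow> ((nat \<Rightarrow> real) \<Rightarrow> (nat \<Rightarrow> real) \<Rightarrow> real) \<Rightarrow> bool" where
  "compact_semialgebraic_metric_space n X d \<longleftrightarrow>
     semialgebraic_metric_space n X d \<and>
     (\<exists>B. \<forall>x\<in>X. L2_set x {..<n} \<le> B) \<and>
     closedin (Euclidean_space n) X"

definition isometry_onto ::
    "'a set \<Rightarrow> ('a \<Rightarrow> 'a \<Rightarrow> real) \<Rightarrow> 'b set \<Rightarrow> ('b \<Rightarrow> 'b \<Rightarrow> real) \<Rightarrow> ('a \<Rightarrow> 'b) \<Rightarrow> bool" where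
  "isometry_onto X dX Y dY f \<longleftrightarrow>
     bij_betw f X Y \<and> (\<forall>x\<in>X. \<forall>x'\<in>X. dY (f x) (f x') = dX x x')"

end

theory Submission
  imports Defs "HOL-Real_Asymp.Real_Asymp"
begin

text \<open>
  Both spaces are the disc \<open>\<bar>x\<^sub>0\<bar> + \<bar>x\<^sub>1\<bar> \<le> 1\<close> in the plane, with polar coordinates \<open>r\<close> (the taxicab norm)
  and \<open>t \<in> \<real>/\<int>\<close> (the angle, which is piecewise rational in the coordinates). The map
  \<open>(r, t) \<mapsto> (r, t + 1/r)\<close> winds infinitely often around the origin, so it is not semialgebraic.
  Its increments are better behaved: where \<open>1/r - 1/s\<close> is bounded, the distance from
  \<open>t - t' - (1/r - 1/s)\<close> to the nearest integer is a minimum of finitely many rational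
  expressions.

  So the metrics compare angles only at points whose \<open>1/r\<close> differ by a bounded amount, which means
  that \<open>\<bar>r - s\<bar>\<close> is at most of order \<open>r\<^sup>2\<close>. This is achieved by truncation: with \<open>\<parallel>u\<parallel>\<close> the distance
  of \<open>u\<close> to the nearest integer, \<open>twisted_dist \<kappa>\<close> is the minimum of \<open>r\<^sup>2 + s\<^sup>2\<close> and
  \<open>3 \<bar>r - s\<bar> + 4 (min r s)\<^sup>2 \<parallel>(t - \<kappa>/r) - (t' - \<kappa>/s)\<parallel>\<close>.
  The former is the length of a detour through the origin; it attains the minimum as soon as
  \<open>3 \<bar>r - s\<bar> \<ge> r\<^sup>2 + s\<^sup>2\<close>, and then the angles do not matter. Hence both \<open>twisted_dist 0\<close> and
  \<open>twisted_dist 1\<close> are semialgebraic (\<open>semialgebraic_twisted_dist\<close>), and the map above is an isometry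
  from the first to the second (\<open>isometry_twist\<close>).

  Conversely, every isometry \<open>f\<close> has to wind around the origin. It fixes the origin, the only point
  from which no distance exceeds 1, and therefore preserves \<open>r\<close>. Let \<open>r\<^sub>k = 2/(k+2)\<close>, so that
  \<open>1/r\<^sub>k = 1 + k/2\<close>, and let \<open>p\<^sub>k\<close> be the point of radius \<open>r\<^sub>k\<close> on a fixed ray. The distance of \<open>p\<^sub>k\<close> and
  \<open>p\<^bsub>k+1\<^esub>\<close> has the value \<open>3 \<bar>r\<^sub>k - r\<^bsub>k+1\<^esub>\<bar>\<close>, which is below the truncation, so the images must have the same
  twisted angle, and the angle of \<open>f(p\<^sub>k)\<close> advances by \<open>1/2\<close> at each step. So the linear ray
  \<open>s \<mapsto> (s p\<^sub>0, s f(p\<^sub>0))\<close> meets the graph of \<open>f\<close> at \<open>s = r\<^sub>k\<close> exactly for even \<open>k\<close>. A semialgebraic set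
  either contains or misses an initial segment of every ray (\<open>semialgebraic_on_ray\<close>), a
  contradiction.
\<close>

section \<open>Semialgebraic sets and piecewise rational functions\<close>

lemma semialgebraic_Int:
  assumes "semialgebraic n S" "semialgebraic n T"
  shows "semialgebraic n (S \<inter> T)"
proof -
  let ?U = "topspace (Euclidean_space n)"
  have "S \<inter> T = ?U - ((?U - S) \<union> (?U - T))"
    using assms[THEN semialgebraic_subset] by auto
  then show ?thesis
    using assms by (simp add: semialgebraic.intros)
qed

lemma semialgebraic_Collect_conj:
  assumes "semialgebraic n {x \<in> topspace (Euclidean_space n). P x}"
    and "semialgebraic n {x \<in> topspace (Euclidean_space n). Q x}"
  shows "semialgebraic n {x \<in> topspace (Euclidean_space n). P x \<and> Q x}"
  using semialgebraic_Int[OF assms] by (simp add: Int_def conj_ac cong: conj_cong)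

lemma semialgebraic_Collect_disj:
  assumes "semialgebraic n {x \<in> topspace (Euclidean_space n). P x}"
    and "semialgebraic n {x \<in> topspace (Euclidean_space n). Q x}"
  shows "semialgebraic n {x \<in> topspace (Euclidean_space n). P x \<or> Q x}"
proof -
  have "{x \<in> topspace (Euclidean_space n). P x \<or> Q x} =
    {x \<in> topspace (Euclidean_space n). P x} \<union> {x \<in> topspace (Euclidean_space n). Q x}" by auto
  then show ?thesis using semialgebraic.union[OF assms] by simp
qed

lemma semialgebraic_Collect_not:
  assumes "semialgebraic n {x \<in> topspace (Euclidean_space n). P x}"
  shows "semialgebraic n {x \<in> topspace (Euclidean_space n). \<not> P x}"
proof -
  have "{x \<in> topspace (Euclidean_space n). \<not> P x} =
    topspace (Euclidean_space n) - {x \<in> topspace (Euclidean_space n). P x}" by auto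
  then show ?thesis using semialgebraic.compl[OF assms] by simp
qed

text \<open>
  Quotients of polynomials, with \<open>a / 0 = 0\<close>, closed under case distinctions along semialgebraic sets.
  All formulas below (norms, minima, angles) are functions of this kind, so their semialgebraicity
  follows from closure rules, without projections.
\<close>

inductive piecewise_rational :: "nat \<Rightarrow> ((nat \<Rightarrow> real) \<Rightarrow> real) \<Rightarrow> bool" for n where
  quot: "polynomial_fun n f \<Longrightarrow> polynomial_fun n g \<Longrightarrow> piecewise_rational n (\<lambda>x. f x / g x)"
| branch: "semialgebraic n {x \<in> topspace (Euclidean_space n). P x} \<Longrightarrow>
    piecewise_rational n F \<Longrightarrow> piecewise_rational n G \<Longrightarrow>
    piecewise_rational n (\<lambda>x. if P x then F x else G x)"

lemma piecewise_rational_polynomial: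
  assumes "polynomial_fun n f"
  shows "piecewise_rational n f"
  using piecewise_rational.quot[OF assms polynomial_fun.const[of n 1]] by simp

lemma piecewise_rational_const: "piecewise_rational n (\<lambda>x. c)"
  by (rule piecewise_rational_polynomial[OF polynomial_fun.const])

lemma piecewise_rational_coord: "i < n \<Longrightarrow> piecewise_rational n (\<lambda>x. x i)"
  by (rule piecewise_rational_polynomial[OF polynomial_fun.coord])

lemma semialgebraic_pos:
  assumes "piecewise_rational n F"
  shows "semialgebraic n {x \<in> topspace (Euclidean_space n). 0 < F x}"
  using assms
proof induction
  case (quot f g)
  have "{x \<in> topspace (Euclidean_space n). 0 < f x / g x} =
      {x \<in> topspace (Euclidean_space n). f x * g x > 0}"
    by (auto simp: zero_less_divide_iff zero_less_mult_iff)
  then show ?case using quot by (simp add: semialgebraic.pos polynomial_fun.mult)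
next
  case (branch P F G)
  have "{x \<in> topspace (Euclidean_space n). 0 < (if P x then F x else G x)} =
     {x \<in> topspace (Euclidean_space n). (P x \<and> 0 < F x) \<or> (\<not> P x \<and> 0 < G x)}"
    by auto
  then show ?case
    using branch by (simp add: semialgebraic_Collect_conj semialgebraic_Collect_disj
        semialgebraic_Collect_not del: if_split)
qed

lemma semialgebraic_nonzero_polynomial:
  assumes "polynomial_fun n g"
  shows "semialgebraic n {x \<in> topspace (Euclidean_space n). g x \<noteq> 0}"
  using semialgebraic.pos[OF polynomial_fun.mult[OF assms assms]]
  by (simp add: zero_less_mult_iff linorder_neq_iff disj_commute)

text \<open>
  Case distinctions are pulled out of both summands, which leaves sums of two quotients. Since
  \<open>a / 0 = 0\<close>, the common denominator may only be formed where both denominators are nonzero.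
\<close>

lemma piecewise_rational_add:
  assumes "piecewise_rational n F" "piecewise_rational n G"
  shows "piecewise_rational n (\<lambda>x. F x + G x)"
  using assms(1)
proof induction
  case (quot f g)
  note fg = quot
  show ?case using assms(2)
  proof induction
    case (quot f' g')
    have "(\<lambda>x. f x / g x + f' x / g' x) = (\<lambda>x.
        if g x \<noteq> 0 then
          (if g' x \<noteq> 0 then (f x * g' x + f' x * g x) / (g x * g' x) else f x / g x)
        else f' x / g' x)"
      by (auto simp: fun_eq_iff field_simps)
    then show ?case using fg quot
      by (simp add: piecewise_rational.intros polynomial_fun.intros semialgebraic_nonzero_polynomial
          del: if_split)
  next
    case (branch P F' G')
    have "(\<lambda>x. f x / g x + (if P x then F' x else G' x)) =
        (\<lambda>x. if P x then f x / g x + F' x else f x / g x + G' x)" by auto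
    then show ?case using branch by (simp add: piecewise_rational.branch del: if_split)
  qed
next
  case (branch P F' G')
  have "(\<lambda>x. (if P x then F' x else G' x) + G x) =
      (\<lambda>x. if P x then F' x + G x else G' x + G x)" by auto
  then show ?case using branch by (simp add: piecewise_rational.branch del: if_split)
qed

lemma piecewise_rational_mult:
  assumes "piecewise_rational n F" "piecewise_rational n G"
  shows "piecewise_rational n (\<lambda>x. F x * G x)"
  using assms(1)
proof induction
  case (quot f g)
  note fg = quot
  show ?case using assms(2)
  proof induction
    case (quot f' g')
    then show ?case using fg
      by (simp add: piecewise_rational.quot polynomial_fun.mult)
  next
    case (branch P F' G')
    have "(\<lambda>x. f x / g x * (if P x then F' x else G' x)) =
        (\<lambda>x. if P x then f x / g x * F' x else f x / g x * G' x)" by auto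
    then show ?case using branch by (simp add: piecewise_rational.branch del: if_split)
  qed
next
  case (branch P F' G')
  have "(\<lambda>x. (if P x then F' x else G' x) * G x) =
      (\<lambda>x. if P x then F' x * G x else G' x * G x)" by auto
  then show ?case using branch by (simp add: piecewise_rational.branch del: if_split)
qed

lemma piecewise_rational_inverse:
  assumes "piecewise_rational n F"
  shows "piecewise_rational n (\<lambda>x. inverse (F x))"
  using assms
proof induction
  case (quot f g)
  then show ?case by (simp add: piecewise_rational.quot)
next
  case (branch P F G)
  have "(\<lambda>x. inverse (if P x then F x else G x)) =
      (\<lambda>x. if P x then inverse (F x) else inverse (G x))" by auto
  then show ?case using branch by (simp add: piecewise_rational.branch del: if_split)
qed

lemma piecewise_rational_divide:
  assumes "piecewise_rational n F" "piecewise_rational n G"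
  shows "piecewise_rational n (\<lambda>x. F x / G x)"
  unfolding divide_inverse
  by (intro piecewise_rational_mult piecewise_rational_inverse assms)

lemma piecewise_rational_minus:
  assumes "piecewise_rational n F"
  shows "piecewise_rational n (\<lambda>x. - F x)"
  using piecewise_rational_mult[OF piecewise_rational_const[of n "-1"] assms] by simp

lemma piecewise_rational_diff:
  assumes "piecewise_rational n F" "piecewise_rational n G"
  shows "piecewise_rational n (\<lambda>x. F x - G x)"
  using piecewise_rational_add[OF assms(1) piecewise_rational_minus[OF assms(2)]] by simp

lemma piecewise_rational_power:
  assumes "piecewise_rational n F"
  shows "piecewise_rational n (\<lambda>x. F x ^ k)"
  by (induction k) (simp_all add: piecewise_rational_const piecewise_rational_mult assms)

lemma semialgebraic_less:
  assumes "piecewise_rational n F" "piecewise_rational n G"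
  shows "semialgebraic n {x \<in> topspace (Euclidean_space n). F x < G x}"
  using semialgebraic_pos[OF piecewise_rational_diff[OF assms(2,1)]] by simp

lemma semialgebraic_le:
  assumes "piecewise_rational n F" "piecewise_rational n G"
  shows "semialgebraic n {x \<in> topspace (Euclidean_space n). F x \<le> G x}"
  using semialgebraic_Collect_not[OF semialgebraic_less[OF assms(2,1)]] by (simp add: not_less)

lemma semialgebraic_eq:
  assumes "piecewise_rational n F" "piecewise_rational n G"
  shows "semialgebraic n {x \<in> topspace (Euclidean_space n). F x = G x}"
  using semialgebraic_Collect_conj[OF semialgebraic_le[OF assms] semialgebraic_le[OF assms(2,1)]]
  by (simp add: order_eq_iff)

lemma piecewise_rational_min:
  assumes "piecewise_rational n F" "piecewise_rational n G"
  shows "piecewise_rational n (\<lambda>x. min (F x) (G x))"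
  unfolding min_def by (intro piecewise_rational.branch semialgebraic_le assms)

lemma piecewise_rational_abs:
  assumes "piecewise_rational n F"
  shows "piecewise_rational n (\<lambda>x. \<bar>F x\<bar>)"
  unfolding abs_if
  by (intro piecewise_rational.branch semialgebraic_less assms piecewise_rational_minus
      piecewise_rational_const)

lemmas piecewise_rational_intros =
  piecewise_rational_const piecewise_rational_coord piecewise_rational_add piecewise_rational_mult
  piecewise_rational_divide piecewise_rational_minus piecewise_rational_diff
  piecewise_rational_power piecewise_rational_min piecewise_rational_abs piecewise_rational.branch
  semialgebraic_less semialgebraic_le semialgebraic_eq

section \<open>Semialgebraic sets along a ray\<close>

lemma polynomial_fun_on_line:
  assumes "polynomial_fun n f"
  shows "\<exists>p. \<forall>s. f (\<lambda>i. s * v i) = poly p s"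
  using assms
proof induction
  case (const c)
  then show ?case by (intro exI[of _ "[:c:]"]) simp
next
  case (coord i)
  then show ?case by (intro exI[of _ "[:0, v i:]"]) simp
next
  case (add f g)
  then show ?case by (metis poly_add)
next
  case (mult f g)
  then show ?case by (metis poly_mult)
qed

text \<open>
  The constant coefficient decides the sign near 0; if it is 0, then the polynomial has the sign of its
  quotient by the variable.
\<close>

lemma poly_sign_eventually:
  fixes p :: "real poly"
  shows "(\<forall>\<^sub>F s in at_right 0. poly p s > 0) \<or> (\<forall>\<^sub>F s in at_right 0. \<not> poly p s > 0)"
proof (induction p)
  case 0
  then show ?case by simp
next
  case (pCons a p)
  have lim: "(poly (pCons a p) \<longlongrightarrow> a) (at_right 0)"
    using tendsto_poly[OF tendsto_ident_at, of "pCons a p" 0 "{0<..}"]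
    by (simp del: poly_pCons add: poly_pCons[of a p 0])
  consider "a > 0" | "a < 0" | "a = 0" by linarith
  then show ?case
  proof cases
    case 1
    then show ?thesis using order_tendstoD(1)[OF lim, of 0] by simp
  next
    case 2
    have "\<forall>\<^sub>F s in at_right 0. \<not> poly (pCons a p) s > 0"
      using order_tendstoD(2)[OF lim 2] by eventually_elim (simp del: poly_pCons)
    then show ?thesis ..
  next
    case 3
    have "\<forall>\<^sub>F s in at_right 0. (poly (pCons a p) s > 0) = (poly p s > 0)"
      using eventually_at_right_less[of "0::real"]
      by eventually_elim (simp add: 3 zero_less_mult_iff)
    note pos_iff = this
    have "\<forall>\<^sub>F s in at_right 0. poly (pCons a p) s > 0" if "\<forall>\<^sub>F s in at_right 0. poly p s > 0"
      using pos_iff that by eventually_elim simp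
    moreover have "\<forall>\<^sub>F s in at_right 0. \<not> poly (pCons a p) s > 0"
      if "\<forall>\<^sub>F s in at_right 0. \<not> poly p s > 0"
      using pos_iff that by eventually_elim simp
    ultimately show ?thesis using pCons.IH by blast
  qed
qed

text \<open>
  The only restriction on semialgebraic sets that the non-existence part relies on: on a ray, a
  polynomial function of the coordinates is a polynomial in one variable, so its sign is constant near
  the origin, and this dichotomy survives Boolean operations.
\<close>

lemma semialgebraic_on_ray:
  assumes "semialgebraic n S" and v: "v \<in> topspace (Euclidean_space n)"
  shows "(\<forall>\<^sub>F s in at_right 0. (\<lambda>i. s * v i) \<in> S) \<or> (\<forall>\<^sub>F s in at_right 0. (\<lambda>i. s * v i) \<notin> S)"
  using assms(1)
proof induction
  have on_ray: "(\<lambda>i. s * v i) \<in> topspace (Euclidean_space n)" for s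
    using v by (simp add: topspace_Euclidean_space)
  {
    case (pos f)
    obtain p where "\<And>s. f (\<lambda>i. s * v i) = poly p s"
      using polynomial_fun_on_line[OF pos] by metis
    then show ?case using poly_sign_eventually[of p] on_ray by simp
  next
    case (compl S)
    then show ?case using on_ray by auto
  next
    case (union S T)
    have "\<forall>\<^sub>F s in at_right 0. (\<lambda>i. s * v i) \<notin> S \<union> T"
      if "\<forall>\<^sub>F s in at_right 0. (\<lambda>i. s * v i) \<notin> S" "\<forall>\<^sub>F s in at_right 0. (\<lambda>i. s * v i) \<notin> T"
      using that by eventually_elim simp
    moreover have "\<forall>\<^sub>F s in at_right 0. (\<lambda>i. s * v i) \<in> S \<union> T"
      if "\<forall>\<^sub>F s in at_right 0. (\<lambda>i. s * v i) \<in> A" "A \<subseteq> S \<union> T" for A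
      using that(1) by eventually_elim (use that(2) in blast)
    ultimately show ?case using union.IH by (meson Un_upper1 Un_upper2)
  }
qed

section \<open>Distance to the nearest integer\<close>

definition int_dist :: "real \<Rightarrow> real" where
  "int_dist x = \<bar>x - of_int (round x)\<bar>"

lemma int_dist_le: "int_dist x \<le> \<bar>x - of_int k\<bar>"
  unfolding int_dist_def using round_diff_minimal by blast

lemma int_dist_le_abs: "int_dist x \<le> \<bar>x\<bar>"
  using int_dist_le[of x 0] by simp

lemma int_dist_nonneg: "0 \<le> int_dist x"
  by (simp add: int_dist_def)

lemma int_dist_le_half: "int_dist x \<le> 1/2"
  unfolding int_dist_def using of_int_round_abs_le[of x] by (simp add: abs_minus_commute)

lemma int_dist_eq_0_iff: "int_dist x = 0 \<longleftrightarrow> x \<in> \<int>"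
  unfolding int_dist_def by (metis Ints_cases Ints_of_int abs_eq_0 eq_iff_diff_eq_0 round_of_int)

lemma int_dist_triangle: "int_dist (x + y) \<le> int_dist x + int_dist y"
  using int_dist_le[of "x + y" "round x + round y"] unfolding int_dist_def by simp

lemma int_dist_cong:
  assumes "x - y \<in> \<int>"
  shows "int_dist x = int_dist y"
proof -
  have "y - x \<in> \<int>" using assms Ints_minus by fastforce
  then show ?thesis
    using int_dist_triangle[of "x - y" y] int_dist_triangle[of "y - x" x] assms
      int_dist_eq_0_iff[of "x - y"] int_dist_eq_0_iff[of "y - x"] by simp
qed

lemma int_dist_minus: "int_dist (- x) = int_dist x"
  using int_dist_le[of "- x" "- round x"] int_dist_le[of x "- round (- x)"]
  unfolding int_dist_def by simp

lemma int_dist_commute: "int_dist (x - y) = int_dist (y - x)"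
  using int_dist_minus[of "x - y"] by simp

lemma int_dist_half: "int_dist (1/2) = 1/2"
  by (simp add: int_dist_def round_def)

text \<open>
  On a bounded interval only finitely many integers compete, which makes the function piecewise
  linear there. Globally it has infinitely many corners and is not semialgebraic.
\<close>

lemma int_dist_eq_min:
  assumes "\<bar>x\<bar> \<le> 2"
  shows "int_dist x = min \<bar>x\<bar> (min \<bar>\<bar>x\<bar> - 1\<bar> \<bar>\<bar>x\<bar> - 2\<bar>)"
proof -
  let ?y = "\<bar>x\<bar>"
  have eq: "int_dist x = int_dist ?y" using int_dist_minus[of x] by (cases "x \<ge> 0") auto
  have le: "int_dist ?y \<le> ?y" "int_dist ?y \<le> \<bar>?y - 1\<bar>" "int_dist ?y \<le> \<bar>?y - 2\<bar>"
    using int_dist_le[of ?y 0] int_dist_le[of ?y 1] int_dist_le[of ?y 2] by simp_all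
  have half: "\<bar>?y - of_int (round ?y)\<bar> \<le> 1/2" using int_dist_le_half[of ?y] by (simp add: int_dist_def)
  have "real_of_int (round ?y) > -1" "real_of_int (round ?y) < 3"
    using half assms by linarith+
  then have "round ?y \<in> {0, 1, 2}" by auto
  then have "int_dist ?y \<in> {?y, \<bar>?y - 1\<bar>, \<bar>?y - 2\<bar>}" by (auto simp: int_dist_def)
  moreover have "d = min a (min b c)" if "d \<in> {a, b, c}" "d \<le> a" "d \<le> b" "d \<le> c"
    for a b c d :: real
    using that by (auto simp: min_def)
  ultimately show ?thesis unfolding eq using le by blast
qed

section \<open>Polar coordinates on the plane for the taxicab norm\<close>

definition radius :: "(nat \<Rightarrow> real) \<Rightarrow> real" where
  "radius x = \<bar>x 0\<bar> + \<bar>x 1\<bar>"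

text \<open>
  An arc length coordinate on the diamond \<open>radius x = 1\<close>, of total length 1. It runs through
  \<open>[-1/2, 1/2)\<close> and jumps at the negative first coordinate axis, but it is continuous modulo integers.
  At the origin it has the value \<open>-1/4\<close>, because \<open>0 / 0 = 0\<close>; there
  its uses are weighted by a power of the radius.
\<close>

definition angle :: "(nat \<Rightarrow> real) \<Rightarrow> real" where
  "angle x = (if x 1 > 0 then (1 - x 0 / radius x) / 4 else - ((1 - x 0 / radius x) / 4))"

lemma radius_nonneg: "0 \<le> radius x"
  by (simp add: radius_def)

lemma radius_scale: "0 \<le> c \<Longrightarrow> radius (\<lambda>i. c * x i) = c * radius x"
  by (simp add: radius_def abs_mult distrib_left)

lemma angle_scale: "0 < c \<Longrightarrow> angle (\<lambda>i. c * x i) = angle x"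
  using radius_scale[of c x] by (simp add: angle_def zero_less_mult_iff)

lemma coord_div_radius_bounds:
  "- 1 \<le> x 0 / radius x" "x 0 / radius x \<le> 1"
  "x 1 > 0 \<Longrightarrow> - 1 < x 0 / radius x" "x 1 > 0 \<Longrightarrow> x 0 / radius x < 1"
proof -
  have r: "\<bar>x 0\<bar> \<le> radius x" "x 1 > 0 \<Longrightarrow> \<bar>x 0\<bar> < radius x"
    by (simp_all add: radius_def)
  consider "radius x = 0" "\<not> x 1 > 0" | "radius x > 0"
    using r by linarith
  then show "- 1 \<le> x 0 / radius x" "x 0 / radius x \<le> 1"
    "x 1 > 0 \<Longrightarrow> - 1 < x 0 / radius x" "x 1 > 0 \<Longrightarrow> x 0 / radius x < 1"
    using r by (cases; simp add: field_simps)+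
qed

lemma angle_eq:
  "x 1 > 0 \<Longrightarrow> angle x = (1 - x 0 / radius x) / 4"
  "\<not> x 1 > 0 \<Longrightarrow> angle x = - ((1 - x 0 / radius x) / 4)"
  by (simp_all add: angle_def)

lemma angle_bounds: "- 1/2 \<le> angle x" "angle x < 1/2"
  and angle_pos_iff: "angle x > 0 \<longleftrightarrow> x 1 > 0"
proof -
  obtain u where u: "x 0 / radius x = u" by blast
  note b = coord_div_radius_bounds[of x, unfolded u] angle_eq[of x, unfolded u]
  have "- 1/2 \<le> angle x \<and> angle x < 1/2 \<and> (angle x > 0 \<longleftrightarrow> x 1 > 0)"
  proof (cases "x 1 > 0")
    case True
    then show ?thesis using b(3-5)[OF True] True by simp
  next
    case False
    then show ?thesis using b(1,2) b(6)[OF False] False by simp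
  qed
  then show "- 1/2 \<le> angle x" "angle x < 1/2" "angle x > 0 \<longleftrightarrow> x 1 > 0" by blast+
qed

lemma polar_coordinates_unique:
  assumes x: "x \<in> topspace (Euclidean_space 2)" and y: "y \<in> topspace (Euclidean_space 2)"
    and r: "radius x = radius y" and t: "radius x = 0 \<or> angle x - angle y \<in> \<int>"
  shows "x = y"
proof -
  have "x 0 = y 0 \<and> x 1 = y 1"
  proof (cases "radius x = 0")
    case True
    then show ?thesis using r by (simp add: radius_def add_nonneg_eq_0_iff)
  next
    case False
    then have pos: "radius x > 0" using radius_nonneg[of x] by linarith
    obtain k where k: "angle x - angle y = of_int k" using t False by (auto elim: Ints_cases)
    have "\<bar>real_of_int k\<bar> < 1" using angle_bounds[of x] angle_bounds[of y] k by linarith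
    then have "k = 0" by linarith
    then have a: "angle x = angle y" using k by simp
    then have sg: "x 1 > 0 \<longleftrightarrow> y 1 > 0" using angle_pos_iff by metis
    obtain u v where uv: "x 0 / radius x = u" "y 0 / radius y = v" by blast
    have "u = v"
      using a sg angle_eq[of x, unfolded uv] angle_eq[of y, unfolded uv] by (cases "x 1 > 0") simp_all
    then have "x 0 / radius x = y 0 / radius y" using uv by simp
    then have x0: "x 0 = y 0" using r pos by simp
    then have "\<bar>x 1\<bar> = \<bar>y 1\<bar>" using r by (simp add: radius_def)
    then show ?thesis using sg x0 by linarith
  qed
  moreover have "x i = y i" if "i \<ge> 2" for i
    using x y that by (simp add: topspace_Euclidean_space)
  ultimately show ?thesis by (metis One_nat_def Suc_1 less_2_cases not_less ext)
qed

text \<open>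
  The inverse of the polar coordinates, with the angle given modulo integers: the representative \<open>u\<close>
  lies in \<open>[-1/2, 1/2)\<close>, like the values of \<open>angle\<close>.
\<close>

definition polar :: "real \<Rightarrow> real \<Rightarrow> nat \<Rightarrow> real" where
  "polar r t = (let u = t - of_int (round t) in (\<lambda>i.
     if i = 0 then r * (1 - 4 * \<bar>u\<bar>)
     else if i = 1 then r * ((1 - \<bar>1 - 4 * \<bar>u\<bar>\<bar>) * (if u > 0 then 1 else -1)) else 0))"

lemma polar_in_plane: "polar r t \<in> topspace (Euclidean_space 2)"
  by (simp add: polar_def topspace_Euclidean_space Let_def)

lemma fraction_bounds: "- 1/2 \<le> t - real_of_int (round t)" "t - real_of_int (round t) < 1/2"
  using floor_correct[of "t + 1/2"] unfolding round_def by linarith+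

lemma radius_polar:
  assumes "0 \<le> r"
  shows "radius (polar r t) = r"
proof -
  define u where "u = t - of_int (round t)"
  have "\<bar>u\<bar> \<le> 1/2" using fraction_bounds[of t] unfolding u_def by linarith
  then have "\<bar>1 - 4 * \<bar>u\<bar>\<bar> \<le> 1" by linarith
  then show ?thesis
    using assms unfolding radius_def polar_def Let_def u_def[symmetric]
    by (simp add: abs_mult right_diff_distrib[symmetric] distrib_left[symmetric])
qed

lemma angle_polar:
  assumes "0 < r"
  shows "angle (polar r t) - t \<in> \<int>"
proof -
  define u where "u = t - of_int (round t)"
  have b: "\<bar>1 - 4 * \<bar>u\<bar>\<bar> \<le> 1" "u > 0 \<Longrightarrow> \<bar>1 - 4 * \<bar>u\<bar>\<bar> < 1"
    using fraction_bounds[of t] unfolding u_def[symmetric] by linarith+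
  have p: "polar r t 0 = r * (1 - 4 * \<bar>u\<bar>)"
    "polar r t 1 = r * ((1 - \<bar>1 - 4 * \<bar>u\<bar>\<bar>) * (if u > 0 then 1 else -1))"
    by (simp_all add: polar_def Let_def u_def)
  have "angle (polar r t) = u"
  proof (cases "u > 0")
    case True
    then have "polar r t 1 > 0" unfolding p using b assms by simp
    then show ?thesis using True assms p by (simp add: angle_def radius_polar)
  next
    case False
    then have "\<not> polar r t 1 > 0" unfolding p using b(1) assms
      by (simp add: not_less mult_le_0_iff)
    then show ?thesis using False assms p by (simp add: angle_def radius_polar)
  qed
  then show ?thesis by (simp add: u_def)
qed

text \<open>
  The shorter arc between two points of the unit diamond is at most twice as long as their taxicab
  distance, and the perimeter, of taxicab length 8, is normalised to 1. On each side of the first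
  axis the angle is linear in the first coordinate. Points on different sides are joined by the arc
  through a corner on this axis if their first coordinates have the same sign; otherwise their
  distance is at least 2, which is half of the longest possible arc, 4.
\<close>

lemma angle_lipschitz:
  assumes "radius x > 0" "radius y > 0"
  shows "int_dist (angle x - angle y)
    \<le> (\<bar>x 0 / radius x - y 0 / radius y\<bar> + \<bar>x 1 / radius x - y 1 / radius y\<bar>) / 4"
proof -
  define u v u' v' where "u = x 0 / radius x" "v = x 1 / radius x"
    "u' = y 0 / radius y" "v' = y 1 / radius y"
  note defs = this
  have n: "\<bar>u\<bar> + \<bar>v\<bar> = 1" "\<bar>u'\<bar> + \<bar>v'\<bar> = 1"
    using assms by (simp_all add: defs radius_def add_divide_distrib[symmetric])
  have sg: "x 1 > 0 \<longleftrightarrow> v > 0" "y 1 > 0 \<longleftrightarrow> v' > 0"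
    using assms by (simp_all add: defs zero_less_divide_iff)
  have a: "angle x = (if v > 0 then (1 - u) / 4 else - ((1 - u) / 4))"
    "angle y = (if v' > 0 then (1 - u') / 4 else - ((1 - u') / 4))"
    unfolding angle_def sg by (simp_all only: defs)
  have "int_dist (angle x - angle y) \<le> (\<bar>u - u'\<bar> + \<bar>v - v'\<bar>) / 4"
    using n int_dist_le[of "angle x - angle y" 0] int_dist_le[of "angle x - angle y" 1]
      int_dist_le[of "angle x - angle y" "-1"] int_dist_le_half[of "angle x - angle y"]
    unfolding a by (cases "0 < v"; cases "0 < v'"; cases "0 \<le> u"; cases "0 \<le> u'"; simp; argo)
  then show ?thesis by (simp add: defs)
qed

section \<open>The twisted metrics on the taxicab disc\<close>

definition disc :: "(nat \<Rightarrow> real) set" where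
  "disc = {x \<in> topspace (Euclidean_space 2). radius x \<le> 1}"

definition twisted_angle :: "real \<Rightarrow> (nat \<Rightarrow> real) \<Rightarrow> real" where
  "twisted_angle \<kappa> x = angle x - \<kappa> / radius x"

text \<open>
  The distance along the disc, before the truncation that allows a detour through the origin. The
  factor 3 makes the change of \<open>1/r\<close> before truncation small enough for \<open>int_dist_eq_min\<close>; a factor
  above 4 would hide, near the origin, the steps of length \<open>1/2\<close> in \<open>1/r\<close> that are used in
  \<open>not_semialgebraic_isometry\<close>. On a circle of radius \<open>r\<close> the angular term is at most \<open>2 r\<^sup>2\<close>, so it
  is not truncated there, and its factor 4 creates distances above 1 between opposite points near
  the boundary, see \<open>exists_far_point\<close>.
\<close>

definition direct_dist :: "real \<Rightarrow> (nat \<Rightarrow> real) \<Rightarrow> (nat \<Rightarrow> real) \<Rightarrow> real" where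
  "direct_dist \<kappa> x y = 3 * \<bar>radius x - radius y\<bar> +
     4 * (min (radius x) (radius y))\<^sup>2 * int_dist (twisted_angle \<kappa> x - twisted_angle \<kappa> y)"

definition twisted_dist :: "real \<Rightarrow> (nat \<Rightarrow> real) \<Rightarrow> (nat \<Rightarrow> real) \<Rightarrow> real" where
  "twisted_dist \<kappa> x y = min (direct_dist \<kappa> x y) ((radius x)\<^sup>2 + (radius y)\<^sup>2)"

lemma direct_dist_ge: "3 * \<bar>radius x - radius y\<bar> \<le> direct_dist \<kappa> x y"
  by (simp add: direct_dist_def int_dist_nonneg)

lemma direct_dist_commute: "direct_dist \<kappa> x y = direct_dist \<kappa> y x"
  by (simp add: direct_dist_def abs_minus_commute min.commute
      int_dist_commute[of "twisted_angle \<kappa> x"])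

lemma twisted_dist_commute: "twisted_dist \<kappa> x y = twisted_dist \<kappa> y x"
  by (simp add: twisted_dist_def direct_dist_commute[of \<kappa> x] add.commute)

lemma direct_dist_nonneg: "0 \<le> direct_dist \<kappa> x y"
  by (simp add: direct_dist_def int_dist_nonneg)

lemma twisted_dist_nonneg: "0 \<le> twisted_dist \<kappa> x y"
  by (simp add: twisted_dist_def direct_dist_nonneg)

lemma twisted_dist_self: "twisted_dist \<kappa> x x = 0"
  by (simp add: twisted_dist_def direct_dist_def int_dist_def)

text \<open>
  The triangle inequality for \<open>direct_dist\<close> in terms of radii and angular distances. If the middle radius \<open>s\<close>
  is smaller than \<open>r\<close> and \<open>t\<close>, then the circle on which the angles are compared becomes shorter, but the
  path has to go inwards and outwards again, which costs more than this saves.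
\<close>

lemma cone_triangle:
  fixes r s t a b c :: real
  assumes "0 \<le> r" "0 \<le> s" "0 \<le> t" "r \<le> 1" "t \<le> 1"
    and "0 \<le> a" "0 \<le> b" "c \<le> a + b" "c \<le> 1/2"
  shows "3 * \<bar>r - t\<bar> + 4 * (min r t)\<^sup>2 * c \<le>
    (3 * \<bar>r - s\<bar> + 4 * (min r s)\<^sup>2 * a) + (3 * \<bar>s - t\<bar> + 4 * (min s t)\<^sup>2 * b)"
proof (cases "min r t \<le> s")
  case True
  have "(min r t)\<^sup>2 \<le> (min r s)\<^sup>2" "(min r t)\<^sup>2 \<le> (min s t)\<^sup>2"
    using True assms by (intro power_mono; simp)+
  then have "(min r t)\<^sup>2 * a \<le> (min r s)\<^sup>2 * a" "(min r t)\<^sup>2 * b \<le> (min s t)\<^sup>2 * b"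
    using assms by (simp_all add: mult_right_mono)
  moreover have "(min r t)\<^sup>2 * c \<le> (min r t)\<^sup>2 * a + (min r t)\<^sup>2 * b"
    using mult_left_mono[OF assms(8), of "(min r t)\<^sup>2"] by (simp add: distrib_left)
  moreover have "\<bar>r - t\<bar> \<le> \<bar>r - s\<bar> + \<bar>s - t\<bar>" by linarith
  ultimately show ?thesis by linarith
next
  case False
  define m where "m = min r t"
  have m: "s < m" "m \<le> 1" "m \<le> r" "m \<le> t" "min r s = s" "min s t = s"
    using False assms by (auto simp: m_def)
  have "(m\<^sup>2 - s\<^sup>2) * c \<le> (m\<^sup>2 - s\<^sup>2) * (1/2)"
    using m assms by (intro mult_left_mono) (simp_all add: power_mono)
  also have "m\<^sup>2 - s\<^sup>2 = (m + s) * (m - s)" by (simp add: power2_eq_square algebra_simps)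
  also have "(m + s) * (m - s) * (1/2) \<le> 2 * (m - s) * (1/2)"
    using m by (intro mult_right_mono) simp_all
  finally have "m\<^sup>2 * c \<le> s\<^sup>2 * c + (m - s)" by (simp add: algebra_simps power2_eq_square)
  moreover have "s\<^sup>2 * c \<le> s\<^sup>2 * a + s\<^sup>2 * b"
    using mult_left_mono[OF assms(8), of "s\<^sup>2"] by (simp add: distrib_left)
  moreover have "\<bar>r - t\<bar> + 2 * (m - s) = \<bar>r - s\<bar> + \<bar>s - t\<bar>"
    using m by (auto simp: m_def min_def abs_if)
  moreover have "3 * A + 4 * w \<le> (3 * B + 4 * y) + (3 * C + 4 * z)"
    if "w \<le> u + (m - s)" "u \<le> y + z" "A + 2 * (m - s) = B + C" for A B C u w y z :: real
    using that m(1) by argo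
  ultimately show ?thesis unfolding m(5,6) m_def[symmetric] mult.assoc by blast
qed

lemma direct_dist_triangle:
  assumes "x \<in> disc" "z \<in> disc"
  shows "direct_dist \<kappa> x z \<le> direct_dist \<kappa> x y + direct_dist \<kappa> y z"
  unfolding direct_dist_def
proof (rule cone_triangle)
  show "int_dist (twisted_angle \<kappa> x - twisted_angle \<kappa> z) \<le>
     int_dist (twisted_angle \<kappa> x - twisted_angle \<kappa> y) + int_dist (twisted_angle \<kappa> y - twisted_angle \<kappa> z)"
    using int_dist_triangle[of "twisted_angle \<kappa> x - twisted_angle \<kappa> y"
        "twisted_angle \<kappa> y - twisted_angle \<kappa> z"] by simp
  show "int_dist (twisted_angle \<kappa> x - twisted_angle \<kappa> z) \<le> 1/2" by (rule int_dist_le_half)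
qed (use assms in \<open>simp_all add: radius_nonneg int_dist_nonneg disc_def\<close>)

text \<open>
  The distance to the origin is a short map for \<open>direct_dist\<close>; this is what makes the truncated distance
  satisfy the triangle inequality.
\<close>

lemma square_diff_le:
  fixes r s :: real
  assumes "0 \<le> r" "r \<le> 1" "0 \<le> s" "s \<le> 1"
  shows "r\<^sup>2 \<le> 3 * \<bar>r - s\<bar> + s\<^sup>2"
proof -
  have "r\<^sup>2 - s\<^sup>2 = (r + s) * (r - s)" by (simp add: power2_eq_square algebra_simps)
  also have "\<dots> \<le> (r + s) * \<bar>r - s\<bar>" using assms by (intro mult_left_mono) auto
  also have "\<dots> \<le> 3 * \<bar>r - s\<bar>" using assms by (intro mult_right_mono) auto
  finally show ?thesis by simp
qed

lemma twisted_dist_triangle: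
  assumes "x \<in> disc" "y \<in> disc" "z \<in> disc"
  shows "twisted_dist \<kappa> x z \<le> twisted_dist \<kappa> x y + twisted_dist \<kappa> y z"
proof -
  have r: "0 \<le> radius x" "radius x \<le> 1" "0 \<le> radius y" "radius y \<le> 1" "0 \<le> radius z" "radius z \<le> 1"
    using assms by (simp_all add: disc_def radius_nonneg)
  have "(radius x)\<^sup>2 \<le> direct_dist \<kappa> x y + (radius y)\<^sup>2"
    using square_diff_le[OF r(1-4)] direct_dist_ge[of x y \<kappa>] by linarith
  moreover have "(radius z)\<^sup>2 \<le> direct_dist \<kappa> y z + (radius y)\<^sup>2"
    using square_diff_le[OF r(5,6,3,4)] direct_dist_ge[of y z \<kappa>] by (simp add: abs_minus_commute)
  moreover have "0 \<le> (radius y)\<^sup>2" by simp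
  ultimately show ?thesis
    using direct_dist_triangle[OF assms(1,3), of \<kappa> y] unfolding twisted_dist_def by linarith
qed

lemma direct_dist_eq_0_imp:
  assumes "direct_dist \<kappa> x y = 0"
  shows "radius x = radius y" "radius x = 0 \<or> angle x - angle y \<in> \<int>"
proof -
  show eq: "radius x = radius y"
    using direct_dist_ge[of x y \<kappa>] assms by simp
  then show "radius x = 0 \<or> angle x - angle y \<in> \<int>"
    using assms by (simp add: direct_dist_def twisted_angle_def int_dist_eq_0_iff)
qed

lemma twisted_dist_eq_0_iff:
  assumes "x \<in> disc" "y \<in> disc"
  shows "twisted_dist \<kappa> x y = 0 \<longleftrightarrow> x = y"
proof
  assume d: "twisted_dist \<kappa> x y = 0"
  show "x = y"
  proof (cases "direct_dist \<kappa> x y = 0")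
    case True
    then show ?thesis using direct_dist_eq_0_imp[OF True] polar_coordinates_unique assms
      by (simp add: disc_def)
  next
    case False
    then have "(radius x)\<^sup>2 + (radius y)\<^sup>2 = 0" using d by (simp add: twisted_dist_def min_def split: if_splits)
    then have "radius x = 0" "radius y = 0" by (simp_all add: sum_power2_eq_zero_iff)
    then show ?thesis using polar_coordinates_unique assms by (simp add: disc_def)
  qed
next
  assume "x = y"
  then show "twisted_dist \<kappa> x y = 0" by (simp add: twisted_dist_self)
qed

lemma Metric_space_twisted_dist: "Metric_space disc (twisted_dist \<kappa>)"
  by unfold_locales
    (simp_all add: twisted_dist_nonneg twisted_dist_commute twisted_dist_eq_0_iff twisted_dist_triangle)

lemma tendsto_coord: "((\<lambda>x :: nat \<Rightarrow> real. x i) \<longlongrightarrow> a i) (at a within S)"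
  using continuous_on_product_coordinates[where i = i]
  by (metis continuous_on_def tendsto_within_subset UNIV_I subset_UNIV)

lemma tendsto_radius: "(radius \<longlongrightarrow> radius a) (at a within S)"
  unfolding radius_def [abs_def] by (intro tendsto_intros tendsto_coord)

lemma direct_dist_le:
  assumes "x \<in> disc" "y \<in> disc" "radius x > 0" "radius y > 0"
  shows "direct_dist \<kappa> x y \<le> 3 * \<bar>radius x - radius y\<bar>
    + (\<bar>x 0 / radius x - y 0 / radius y\<bar> + \<bar>x 1 / radius x - y 1 / radius y\<bar>)
    + 4 * \<bar>\<kappa> / radius y - \<kappa> / radius x\<bar>"
proof -
  let ?D = "int_dist (twisted_angle \<kappa> x - twisted_angle \<kappa> y)"
  have "(min (radius x) (radius y))\<^sup>2 \<le> 1"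
    using assms by (intro power_le_one) (auto simp: disc_def)
  then have "(min (radius x) (radius y))\<^sup>2 * ?D \<le> 1 * ?D"
    by (intro mult_right_mono) (simp_all add: int_dist_nonneg)
  moreover have "?D \<le> int_dist (angle x - angle y) + \<bar>\<kappa> / radius y - \<kappa> / radius x\<bar>"
    using int_dist_triangle[of "angle x - angle y" "\<kappa> / radius y - \<kappa> / radius x"]
      int_dist_le_abs[of "\<kappa> / radius y - \<kappa> / radius x"]
    by (simp add: twisted_angle_def algebra_simps)
  moreover have "a + 4 * m * D \<le> a + b + 4 * c" if "m * D \<le> 1 * D" "D \<le> A + c" "A \<le> b / 4"
    for a b c m A D :: real
    using that by linarith
  ultimately show ?thesis
    using angle_lipschitz[OF assms(3,4)] unfolding direct_dist_def by blast
qed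

text \<open>
  At the origin the truncation \<open>r\<^sup>2\<close> forces convergence. Elsewhere \<open>\<kappa> / r\<close> is continuous, and so is
  the angle modulo integers.
\<close>

lemma tendsto_twisted_dist_0:
  assumes a: "a \<in> disc"
  shows "((\<lambda>x. twisted_dist \<kappa> x a) \<longlongrightarrow> 0) (at a within disc)"
proof (cases "radius a = 0")
  case True
  have "((\<lambda>x. (radius x)\<^sup>2 + (radius a)\<^sup>2) \<longlongrightarrow> (radius a)\<^sup>2 + (radius a)\<^sup>2) (at a within disc)"
    by (intro tendsto_intros tendsto_radius)
  then have "((\<lambda>x. (radius x)\<^sup>2 + (radius a)\<^sup>2) \<longlongrightarrow> 0) (at a within disc)"
    using True by simp
  then show ?thesis
    by (rule tendsto_sandwich[rotated 3])
      (auto simp: twisted_dist_def direct_dist_nonneg)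
next
  case False
  then have ra: "radius a > 0" using radius_nonneg[of a] by linarith
  let ?g = "\<lambda>x. 3 * \<bar>radius x - radius a\<bar>
    + (\<bar>x 0 / radius x - a 0 / radius a\<bar> + \<bar>x 1 / radius x - a 1 / radius a\<bar>)
    + 4 * \<bar>\<kappa> / radius a - \<kappa> / radius x\<bar>"
  have "(?g \<longlongrightarrow> ?g a) (at a within disc)"
    using False by (intro tendsto_intros tendsto_radius tendsto_coord) simp_all
  then have g: "(?g \<longlongrightarrow> 0) (at a within disc)" by simp
  have "\<forall>\<^sub>F x in at a within disc. radius x > 0"
    using order_tendstoD(1)[OF tendsto_radius ra] .
  moreover have "\<forall>\<^sub>F x in at a within disc. x \<in> disc"
    by (simp add: eventually_at_filter)
  ultimately have "\<forall>\<^sub>F x in at a within disc. twisted_dist \<kappa> x a \<le> ?g x"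
    by eventually_elim
      (use direct_dist_le[OF _ a _ ra, of _ \<kappa>] in \<open>simp add: twisted_dist_def min.coboundedI1\<close>)
  then show ?thesis
    by (intro tendsto_sandwich[OF _ _ tendsto_const g]) (simp_all add: twisted_dist_nonneg)
qed

text \<open>
  By the triangle inequality, joint continuity of a metric follows from \<open>d x a \<longlongrightarrow> 0\<close> as \<open>x\<close> tends to \<open>a\<close>.
\<close>

lemma continuous_on_twisted_dist: "continuous_on (disc \<times> disc) (\<lambda>(x, y). twisted_dist \<kappa> x y)"
  unfolding continuous_on_eq_continuous_within
proof clarify
  fix a b assume ab: "a \<in> disc" "b \<in> disc"
  let ?d = "twisted_dist \<kappa>" and ?F = "at (a, b) within disc \<times> disc"
  have cont: "continuous (at c within disc) (\<lambda>x. ?d x c)" if "c \<in> disc" for c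
    using tendsto_twisted_dist_0[OF that] by (simp add: continuous_within twisted_dist_self)
  have "continuous ?F (\<lambda>z. ?d (fst z) a)"
    by (rule continuous_within_compose2[where f = fst])
      (auto intro: continuous_intros continuous_within_subset[OF cont] ab)
  then have 1: "((\<lambda>z. ?d (fst z) a) \<longlongrightarrow> 0) ?F"
    by (simp add: continuous_within twisted_dist_self)
  have "continuous ?F (\<lambda>z. ?d (snd z) b)"
    by (rule continuous_within_compose2[where f = snd])
      (auto intro: continuous_intros continuous_within_subset[OF cont] ab)
  then have 2: "((\<lambda>z. ?d (snd z) b) \<longlongrightarrow> 0) ?F"
    by (simp add: continuous_within twisted_dist_self)
  have "((\<lambda>z. ?d (fst z) a + ?d (snd z) b) \<longlongrightarrow> 0) ?F"
    using tendsto_add[OF 1 2] by simp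
  moreover have "\<forall>\<^sub>F z in ?F. norm (?d (fst z) (snd z) - ?d a b) \<le> ?d (fst z) a + ?d (snd z) b"
    unfolding eventually_at_filter
  proof (intro always_eventually allI impI)
    fix z assume "z \<in> disc \<times> disc"
    then have z: "fst z \<in> disc" "snd z \<in> disc" by auto
    show "norm (?d (fst z) (snd z) - ?d a b) \<le> ?d (fst z) a + ?d (snd z) b"
      using twisted_dist_triangle[OF z(1) ab(1) z(2), of \<kappa>] twisted_dist_triangle[OF ab z(2), of \<kappa>]
        twisted_dist_triangle[OF ab(1) z(1) ab(2), of \<kappa>] twisted_dist_triangle[OF z ab(2), of \<kappa>]
        twisted_dist_commute[of \<kappa> a "fst z"] twisted_dist_commute[of \<kappa> b "snd z"]
      unfolding real_norm_def by linarith
  qed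
  ultimately have "((\<lambda>z. ?d (fst z) (snd z) - ?d a b) \<longlongrightarrow> 0) ?F"
    by (rule Lim_null_comparison[rotated])
  then show "continuous ?F (\<lambda>(x, y). ?d x y)"
    by (simp add: continuous_within case_prod_unfold Lim_null[symmetric])
qed

lemma continuous_map_twisted_dist:
  "continuous_map
     (prod_topology (subtopology (Euclidean_space 2) disc) (subtopology (Euclidean_space 2) disc))
     euclideanreal (\<lambda>(x, y). twisted_dist \<kappa> x y)"
proof -
  have "subtopology (Euclidean_space 2) disc = top_of_set disc"
    unfolding Euclidean_space_def subtopology_subtopology euclidean_product_topology
    by (rule arg_cong[where f = "subtopology euclidean"]) (auto simp: disc_def topspace_Euclidean_space)
  then show ?thesis
    using continuous_on_twisted_dist by (simp add: prod_topology_subtopology_eu)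
qed

lemma closedin_disc: "closedin (Euclidean_space 2) disc"
proof -
  have "continuous_on UNIV radius"
    unfolding continuous_on_def by (auto intro: tendsto_radius)
  then have "closed {x. radius x \<le> 1}"
    by (intro closed_Collect_le continuous_on_const)
  moreover have "disc = {x. radius x \<le> 1} \<inter> {x. \<forall>i\<ge>2. x i = 0}"
    by (auto simp: disc_def topspace_Euclidean_space)
  ultimately show ?thesis
    unfolding Euclidean_space_def euclidean_product_topology closedin_subtopology
      closed_closedin[symmetric] by blast
qed

lemma disc_bounded: "x \<in> disc \<Longrightarrow> L2_set x {..<2} \<le> 1"
  using L2_set_le_sum_abs[of x "{..<2}"] by (simp add: disc_def radius_def numeral_2_eq_2)

section \<open>The twisted metrics are semialgebraic\<close>

text \<open>
  Where the angles matter at all, the radii differ by a factor less than 2, so that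
  \<open>\<bar>1/r - 1/s\<bar> < (r\<^sup>2 + s\<^sup>2) / (3 r s) \<le> 5/6\<close>. The twists therefore
  contribute less than 1 to the difference, and the angles at most 1.
\<close>

lemma visible_imp_angle_le:
  assumes x: "x \<in> disc" and y: "y \<in> disc" and k: "\<bar>\<kappa>\<bar> \<le> 1"
    and vis: "3 * \<bar>radius x - radius y\<bar> < (radius x)\<^sup>2 + (radius y)\<^sup>2"
  shows "\<bar>twisted_angle \<kappa> x - twisted_angle \<kappa> y\<bar> \<le> 2"
proof -
  define r s where "r = radius x" "s = radius y"
  note rs = this
  have b: "0 \<le> r" "r \<le> 1" "0 \<le> s" "s \<le> 1"
    using x y by (simp_all add: disc_def radius_nonneg rs)
  have sq: "r\<^sup>2 \<le> r" "s\<^sup>2 \<le> s" using b by (simp_all add: power2_eq_square mult_left_le)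
  have vis': "3 * \<bar>r - s\<bar> < r\<^sup>2 + s\<^sup>2" using vis by (simp add: rs)
  then have "3 * \<bar>r - s\<bar> < r + s" using sq by linarith
  then have ratio: "r < 2 * s" "s < 2 * r" by (simp_all add: abs_less_iff abs_if split: if_splits)
  then have pos: "r > 0" "s > 0" by linarith+
  have "0 \<le> (2 * s - r) * (2 * r - s)" using ratio by simp
  then have "2 * (r\<^sup>2 + s\<^sup>2) \<le> 5 * (r * s)" by (simp add: power2_eq_square algebra_simps)
  moreover have "0 < r * s" using pos by simp
  ultimately have "\<bar>r - s\<bar> \<le> r * s" using vis' by argo
  then have "\<bar>s - r\<bar> / (r * s) \<le> 1" using pos by (simp add: abs_minus_commute)
  then have d: "\<bar>1 / r - 1 / s\<bar> \<le> 1" using pos by (simp add: diff_frac_eq abs_mult)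
  have "\<bar>\<kappa> * (1 / r - 1 / s)\<bar> \<le> 1 * 1"
    unfolding abs_mult using k d by (intro mult_mono) auto
  then have "\<bar>\<kappa> / r - \<kappa> / s\<bar> \<le> 1" by (simp add: right_diff_distrib)
  then show ?thesis
    using angle_bounds[of x] angle_bounds[of y] unfolding twisted_angle_def rs by linarith
qed

text \<open>
  The distance to the nearest integer may be replaced by its piecewise linear form: where the two differ,
  the truncation discards both.
\<close>

lemma twisted_dist_eq:
  assumes "x \<in> disc" "y \<in> disc" "\<bar>\<kappa>\<bar> \<le> 1"
  shows "twisted_dist \<kappa> x y = (let w = \<bar>twisted_angle \<kappa> x - twisted_angle \<kappa> y\<bar> in
    min (3 * \<bar>radius x - radius y\<bar>
       + 4 * (min (radius x) (radius y))\<^sup>2 * min w (min \<bar>w - 1\<bar> \<bar>w - 2\<bar>))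
     ((radius x)\<^sup>2 + (radius y)\<^sup>2))"
proof (cases "3 * \<bar>radius x - radius y\<bar> < (radius x)\<^sup>2 + (radius y)\<^sup>2")
  case True
  show ?thesis
    unfolding twisted_dist_def direct_dist_def Let_def
      int_dist_eq_min[OF visible_imp_angle_le[OF assms True]] by (rule refl)
next
  case False
  have trunc: "min (a + p) c = c" if "\<not> a < c" "0 \<le> p" for a c p :: real
    using that by auto
  show ?thesis
    unfolding twisted_dist_def direct_dist_def Let_def
    by (simp only: trunc[OF False] mult_nonneg_nonneg zero_le_power2 zero_le_numeral
        int_dist_nonneg min.bounded_iff abs_ge_zero simp_thms)
qed

lemma piecewise_rational_radius:
  assumes "i + 1 < n"
  shows "piecewise_rational n (\<lambda>z. radius (\<lambda>j. z (i + j)))"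
  unfolding radius_def by (intro piecewise_rational_intros) (use assms in auto)

lemma piecewise_rational_twisted_angle:
  assumes "i + 1 < n"
  shows "piecewise_rational n (\<lambda>z. twisted_angle \<kappa> (\<lambda>j. z (i + j)))"
  unfolding twisted_angle_def angle_def
  by (intro piecewise_rational_intros piecewise_rational_radius) (use assms in auto)

lemma semialgebraic_disc: "semialgebraic 2 disc"
  using semialgebraic_le[OF piecewise_rational_radius[of 0 2] piecewise_rational_const[of 2 1]]
  by (simp add: disc_def)

text \<open>
  The graph is the set of \<open>z \<in> \<real>\<^sup>5\<close> with \<open>(z\<^sub>0, z\<^sub>1)\<close> and \<open>(z\<^sub>2, z\<^sub>3)\<close> in the disc and \<open>z\<^sub>4\<close> equal to the
  formula of \<open>twisted_dist_eq\<close>, which is piecewise rational in \<open>z\<close>.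
\<close>

lemma semialgebraic_twisted_dist:
  assumes "\<bar>\<kappa>\<bar> \<le> 1"
  shows "semialgebraic (2 + (2 + 1))
    {vec_append 2 x (vec_append 2 y (vec1 (twisted_dist \<kappa> x y))) | x y. x \<in> disc \<and> y \<in> disc}"
proof -
  define R where "R i z = radius (\<lambda>j. z (i + j))" for i :: nat and z :: "nat \<Rightarrow> real"
  define W where "W z = \<bar>twisted_angle \<kappa> (\<lambda>j. z (0 + j)) - twisted_angle \<kappa> (\<lambda>j. z (2 + j))\<bar>"
    for z :: "nat \<Rightarrow> real"
  define D where "D z = min (3 * \<bar>R 0 z - R 2 z\<bar>
       + 4 * (min (R 0 z) (R 2 z))\<^sup>2 * min (W z) (min \<bar>W z - 1\<bar> \<bar>W z - 2\<bar>))
     ((R 0 z)\<^sup>2 + (R 2 z)\<^sup>2)" for z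
  have R: "piecewise_rational 5 (R i)" if "i \<le> 3" for i
    unfolding R_def using that by (intro piecewise_rational_radius) simp
  have W: "piecewise_rational 5 W"
    unfolding W_def
    by (intro piecewise_rational_abs piecewise_rational_diff piecewise_rational_twisted_angle) simp_all
  have D: "piecewise_rational 5 D"
    unfolding D_def by (intro piecewise_rational_intros R W) simp_all
  have coords: "vec_append 2 (\<lambda>j. if j < 2 then z j else 0)
        (vec_append 2 (\<lambda>j. if j < 2 then z (2 + j) else 0) (vec1 (z 4))) = z"
    if "z \<in> topspace (Euclidean_space 5)" for z
  proof
    fix i :: nat
    consider "i = 0" | "i = 1" | "i = 2" | "i = 3" | "i = 4" | "5 \<le> i" by linarith
    then show "vec_append 2 (\<lambda>j. if j < 2 then z j else 0)
        (vec_append 2 (\<lambda>j. if j < 2 then z (2 + j) else 0) (vec1 (z 4))) i = z i"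
      using that by cases (auto simp: vec_append_def vec1_def topspace_Euclidean_space)
  qed
  have D_eq: "D (vec_append 2 x (vec_append 2 y v)) = twisted_dist \<kappa> x y"
    if "x \<in> disc" "y \<in> disc" for x y v
  proof -
    let ?z = "vec_append 2 x (vec_append 2 y v)"
    have radii: "radius (\<lambda>j. ?z (0 + j)) = radius x" "radius (\<lambda>j. ?z (2 + j)) = radius y"
      by (simp_all add: radius_def vec_append_def)
    have "twisted_angle \<kappa> (\<lambda>j. ?z (0 + j)) = twisted_angle \<kappa> x"
      "twisted_angle \<kappa> (\<lambda>j. ?z (2 + j)) = twisted_angle \<kappa> y"
      unfolding twisted_angle_def angle_def radii by (simp_all add: vec_append_def)
    note angles = this
    show ?thesis
      unfolding D_def R_def W_def radii angles twisted_dist_eq[OF that assms] Let_def by (rule refl)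
  qed
  have "{vec_append 2 x (vec_append 2 y (vec1 (twisted_dist \<kappa> x y))) | x y. x \<in> disc \<and> y \<in> disc} =
    {z \<in> topspace (Euclidean_space 5). R 0 z \<le> 1 \<and> R 2 z \<le> 1 \<and> z 4 = D z}" (is "?G = ?S")
  proof (intro equalityI subsetI)
    fix z assume "z \<in> ?G"
    then obtain x y where z: "z = vec_append 2 x (vec_append 2 y (vec1 (twisted_dist \<kappa> x y)))"
      and xy: "x \<in> disc" "y \<in> disc" by blast
    have "z \<in> topspace (Euclidean_space (2 + (2 + 1)))"
      unfolding z by (intro vec_append_in_Euclidean_space vec1_in_Euclidean_space)
    moreover have "R 0 z = radius x" "R 2 z = radius y" "z 4 = twisted_dist \<kappa> x y"
      by (simp_all add: R_def z radius_def vec_append_def vec1_def)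
    ultimately show "z \<in> ?S" using xy D_eq[OF xy] by (simp add: disc_def z)
  next
    fix z assume z: "z \<in> ?S"
    let ?x = "\<lambda>j. if j < 2 then z j else 0" and ?y = "\<lambda>j. if j < 2 then z (2 + j) else 0"
    have xy: "?x \<in> disc" "?y \<in> disc"
      using z by (auto simp: disc_def topspace_Euclidean_space R_def radius_def numeral_2_eq_2 numeral_3_eq_3)
    have split: "vec_append 2 ?x (vec_append 2 ?y (vec1 (z 4))) = z"
      by (rule coords) (use z in simp)
    have "z 4 = twisted_dist \<kappa> ?x ?y"
      using D_eq[OF xy, of "vec1 (z 4)", unfolded split] z by simp
    with split have "z = vec_append 2 ?x (vec_append 2 ?y (vec1 (twisted_dist \<kappa> ?x ?y)))" by simp
    then show "z \<in> ?G" using xy by blast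
  qed
  moreover have "semialgebraic 5 ?S"
    by (intro semialgebraic_Collect_conj piecewise_rational_intros R D) simp_all
  ultimately show ?thesis by simp
qed

lemma compact_semialgebraic_disc:
  assumes "\<bar>\<kappa>\<bar> \<le> 1"
  shows "compact_semialgebraic_metric_space 2 disc (twisted_dist \<kappa>)"
  unfolding compact_semialgebraic_metric_space_def semialgebraic_metric_space_def
  using semialgebraic_disc Metric_space_twisted_dist semialgebraic_twisted_dist[OF assms]
    continuous_map_twisted_dist closedin_disc disc_bounded by blast

section \<open>The twisting isometry\<close>

definition twist :: "(nat \<Rightarrow> real) \<Rightarrow> nat \<Rightarrow> real" where
  "twist x = polar (radius x) (angle x + 1 / radius x)"

lemma radius_twist: "radius (twist x) = radius x"
  by (simp add: twist_def radius_polar radius_nonneg)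

lemma twisted_dist_twist: "twisted_dist 1 (twist x) (twist y) = twisted_dist 0 x y"
proof (cases "radius x = 0 \<or> radius y = 0")
  case True
  then have "min (radius x) (radius y) = 0" using radius_nonneg[of x] radius_nonneg[of y] by auto
  then show ?thesis by (simp add: twisted_dist_def direct_dist_def radius_twist)
next
  case False
  then have pos: "radius x > 0" "radius y > 0"
    using radius_nonneg[of x] radius_nonneg[of y] by linarith+
  have "twisted_angle 1 (twist z) - twisted_angle 0 z \<in> \<int>" if "radius z > 0" for z
    using angle_polar[OF that, of "angle z + 1 / radius z"]
    unfolding twisted_angle_def radius_twist by (simp add: twist_def algebra_simps)
  from Ints_diff[OF this[OF pos(1)] this[OF pos(2)]]
  have "int_dist (twisted_angle 1 (twist x) - twisted_angle 1 (twist y))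
      = int_dist (twisted_angle 0 x - twisted_angle 0 y)"
    by (intro int_dist_cong) (simp add: algebra_simps)
  then show ?thesis by (simp add: twisted_dist_def direct_dist_def radius_twist)
qed

lemma isometry_twist: "isometry_onto disc (twisted_dist 0) disc (twisted_dist 1) twist"
  unfolding isometry_onto_def bij_betw_def
proof (intro conjI ballI)
  show "twisted_dist 1 (twist x) (twist y) = twisted_dist 0 x y" for x y
    by (rule twisted_dist_twist)
  have maps: "twist x \<in> disc" if "x \<in> disc" for x
    using that radius_twist[of x] by (simp add: disc_def twist_def polar_in_plane)
  show "inj_on twist disc"
    by (metis inj_onI maps twisted_dist_eq_0_iff twisted_dist_twist)
  show "twist ` disc = disc"
  proof (intro equalityI subsetI)
    fix y assume y: "y \<in> disc"
    let ?x = "polar (radius y) (angle y - 1 / radius y)"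
    have r: "radius ?x = radius y" by (simp add: radius_polar radius_nonneg)
    have x: "?x \<in> disc" using y r by (simp add: disc_def polar_in_plane)
    have "twist ?x = y"
    proof (rule polar_coordinates_unique)
      show "radius (twist ?x) = 0 \<or> angle (twist ?x) - angle y \<in> \<int>"
      proof (cases "radius y = 0")
        case True
        then show ?thesis using radius_twist[of ?x] r by simp
      next
        case False
        then have pos: "radius y > 0" using radius_nonneg[of y] by linarith
        have "angle ?x - (angle y - 1 / radius y) \<in> \<int>" by (rule angle_polar[OF pos])
        moreover have "angle (twist ?x) - (angle ?x + 1 / radius y) \<in> \<int>"
          unfolding twist_def r by (rule angle_polar[OF pos])
        ultimately have "(angle ?x - (angle y - 1 / radius y)) +
            (angle (twist ?x) - (angle ?x + 1 / radius y)) \<in> \<int>" by (rule Ints_add)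
        then show ?thesis by (simp add: algebra_simps)
      qed
    qed (use y maps[OF x] in \<open>simp_all add: disc_def radius_twist r\<close>)
    then show "y \<in> twist ` disc" using x by force
  qed (use maps in auto)
qed

section \<open>No isometry is semialgebraic\<close>

lemma centre_in_disc: "(\<lambda>i. 0) \<in> disc"
  by (simp add: disc_def topspace_Euclidean_space radius_def)

lemma radius_centre: "radius (\<lambda>i. 0) = 0"
  by (simp add: radius_def)

lemma twisted_dist_centre:
  assumes "x \<in> disc"
  shows "twisted_dist \<kappa> (\<lambda>i. 0) x = (radius x)\<^sup>2"
proof -
  have "(radius x)\<^sup>2 \<le> 3 * radius x"
    using square_diff_le[of "radius x" 0] assms by (simp add: disc_def radius_nonneg)
  then show ?thesis using radius_nonneg[of x]
    by (simp add: twisted_dist_def direct_dist_def radius_centre min_absorb1 min_def)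
qed

text \<open>
  The witness lies on the boundary at the opposite twisted angle. At radius \<open>r\<close> the distance is the
  minimum of \<open>3 (1 - r) + 2 r\<^sup>2 = 2 (r - 3/4)\<^sup>2 + 15/8\<close> and \<open>1 + r\<^sup>2\<close>.
\<close>

lemma exists_far_point:
  assumes x: "x \<in> disc" and r: "radius x > 0"
  shows "\<exists>y\<in>disc. twisted_dist \<kappa> x y > 1"
proof
  \<comment> \<open>The twist at radius 1 is \<open>\<kappa>\<close>, so modulo integers the twisted angle of this point is that of
    \<open>x\<close> shifted by \<open>1/2\<close>.\<close>
  let ?y = "polar 1 (twisted_angle \<kappa> x + \<kappa> - 1/2)"
  have ry: "radius ?y = 1" by (simp add: radius_polar)
  show "?y \<in> disc" using ry by (simp add: disc_def polar_in_plane)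
  have "twisted_angle \<kappa> x - twisted_angle \<kappa> ?y - 1/2 = - (angle ?y - (twisted_angle \<kappa> x + \<kappa> - 1/2))"
    unfolding twisted_angle_def[of \<kappa> ?y] ry by simp
  also have "\<dots> \<in> \<int>" by (intro Ints_minus angle_polar) simp
  finally have "int_dist (twisted_angle \<kappa> x - twisted_angle \<kappa> ?y) = 1/2"
    using int_dist_cong int_dist_half by metis
  moreover have "min (radius x) 1 = radius x" "\<bar>radius x - 1\<bar> = 1 - radius x"
    using x by (simp_all add: disc_def)
  ultimately have "direct_dist \<kappa> x ?y = 3 * (1 - radius x) + 2 * (radius x)\<^sup>2"
    by (simp add: direct_dist_def ry)
  moreover have "0 \<le> 2 * (radius x - 3/4)\<^sup>2" by simp
  ultimately have "direct_dist \<kappa> x ?y > 1" by (simp add: power2_eq_square algebra_simps)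
  then show "twisted_dist \<kappa> x ?y > 1" using r by (simp add: twisted_dist_def ry)
qed

text \<open>
  The origin is the only point from which no distance exceeds 1, so it is preserved, and
  the distance to the origin is the square of the radius.
\<close>

lemma isometry_fixes_radius:
  assumes f: "isometry_onto disc (twisted_dist \<kappa>) disc (twisted_dist \<mu>) f" and x: "x \<in> disc"
  shows "radius (f x) = radius x"
proof -
  let ?o = "\<lambda>i. 0 :: real"
  have maps: "f z \<in> disc" if "z \<in> disc" for z
    using f that by (auto simp: isometry_onto_def bij_betw_def)
  have dist: "twisted_dist \<mu> (f z) (f z') = twisted_dist \<kappa> z z'" if "z \<in> disc" "z' \<in> disc" for z z'
    using f that by (simp add: isometry_onto_def)
  have "twisted_dist \<mu> (f ?o) y \<le> 1" if "y \<in> disc" for y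
  proof -
    obtain z where z: "z \<in> disc" "y = f z"
      using f \<open>y \<in> disc\<close> unfolding isometry_onto_def bij_betw_def by blast
    then have "twisted_dist \<mu> (f ?o) y = (radius z)\<^sup>2"
      using dist[OF centre_in_disc z(1)] twisted_dist_centre[OF z(1)] by simp
    then show ?thesis using z by (simp add: disc_def radius_nonneg power_le_one)
  qed
  then have "radius (f ?o) = 0"
    using exists_far_point[OF maps[OF centre_in_disc]] radius_nonneg[of "f ?o"]
    by (meson linorder_not_less order_less_le)
  then have "f ?o = ?o"
    using polar_coordinates_unique maps[OF centre_in_disc] centre_in_disc radius_centre
    by (simp add: disc_def)
  then have "(radius (f x))\<^sup>2 = (radius x)\<^sup>2"
    using dist[OF centre_in_disc x] twisted_dist_centre[OF x] twisted_dist_centre[OF maps[OF x]] by simp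
  then show ?thesis by (simp add: radius_nonneg)
qed

lemma vec_append_inject:
  assumes eq: "vec_append n x y = vec_append n x' y'"
    and x: "x \<in> topspace (Euclidean_space n)" and x': "x' \<in> topspace (Euclidean_space n)"
  shows "x = x' \<and> y = y'"
proof
  show "x = x'"
  proof
    fix i show "x i = x' i"
      using fun_cong[OF eq, of i] x x'
      by (cases "i < n") (simp_all add: vec_append_def topspace_Euclidean_space)
  qed
  show "y = y'"
  proof
    fix i show "y i = y' i"
      using fun_cong[OF eq, of "i + n"] by (simp add: vec_append_def)
  qed
qed

text \<open>
  Away from the origin, equality in \<open>direct_dist_ge\<close> characterises equal twisted angles. For
  \<open>twisted_dist 0\<close> this means lying on a common ray, for \<open>twisted_dist 1\<close> lying on a common spiral
  \<open>t = c + 1/r\<close>. An isometry thus sends a sequence on a ray, chosen dense enough for the truncation not to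
  interfere, to a sequence on a spiral, which returns to its initial ray infinitely often without
  staying there.
\<close>

lemma not_semialgebraic_isometry:
  assumes f: "isometry_onto disc (twisted_dist 0) disc (twisted_dist 1) f"
  shows "\<not> semialgebraic_map 2 2 disc f"
proof
  assume sa: "semialgebraic_map 2 2 disc f"
  define e :: "nat \<Rightarrow> real" where "e i = (if i = 0 then 1 else 0)" for i
  define r :: "nat \<Rightarrow> real" where "r k = 2 / (real k + 2)" for k
  define p where "p k = (\<lambda>i. r k * e i)" for k
  define q where "q k = f (p k)" for k
  have r: "0 < r k" "r k \<le> 1" "1 / r k = 1 + real k / 2" for k
    by (simp_all add: r_def field_simps)
  have e: "radius e = 1" "e \<in> topspace (Euclidean_space 2)"
    by (simp_all add: e_def radius_def topspace_Euclidean_space)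
  have rp: "radius (p k) = r k" for k
    using r(1)[of k] e by (simp add: p_def radius_scale)
  have p: "p k \<in> disc" for k
    using rp[of k] r(2)[of k] e(2) by (simp add: disc_def p_def topspace_Euclidean_space)
  have rq: "radius (q k) = r k" for k
    using isometry_fixes_radius[OF f p] rp by (simp add: q_def)
  have q: "q k \<in> disc" for k
    using f p by (auto simp: isometry_onto_def bij_betw_def q_def)
  have ap: "angle (p k) = angle e" for k
    using angle_scale[OF r(1)] by (simp add: p_def)
  have step: "angle (q (Suc k)) - angle (q k) - 1/2 \<in> \<int>" for k
  proof -
    let ?r = "r k" and ?s = "r (Suc k)"
    \<comment> \<open>Consecutive points are close enough to see each other's angles: 3 (r - s) = (3/2) r s < 2 r s.\<close>
    have "1 / ?s - 1 / ?r = 1 / 2" unfolding r by (simp add: add_divide_distrib)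
    then have "2 * (?r - ?s) = ?r * ?s" using r(1)[of k] r(1)[of "Suc k"] by (simp add: field_simps)
    moreover have "0 < ?r * ?s" using r(1) by simp
    moreover have "2 * (?r * ?s) \<le> ?r\<^sup>2 + ?s\<^sup>2" using sum_squares_bound[of ?r ?s] by simp
    ultimately have vis: "3 * \<bar>?r - ?s\<bar> < ?r\<^sup>2 + ?s\<^sup>2" by linarith
    have "twisted_dist 0 (p k) (p (Suc k)) = 3 * \<bar>?r - ?s\<bar>"
      using vis by (simp add: twisted_dist_def direct_dist_def rp twisted_angle_def ap int_dist_def)
    then have "twisted_dist 1 (q k) (q (Suc k)) = 3 * \<bar>?r - ?s\<bar>"
      using f p by (simp add: q_def isometry_onto_def)
    then have "direct_dist 1 (q k) (q (Suc k)) = 3 * \<bar>?r - ?s\<bar>"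
      using vis by (simp add: twisted_dist_def rq min_def split: if_splits)
    moreover have "min ?r ?s \<noteq> 0" using r(1)[of k] r(1)[of "Suc k"] by (simp add: min_def)
    ultimately have "twisted_angle 1 (q k) - twisted_angle 1 (q (Suc k)) \<in> \<int>"
      by (simp add: direct_dist_def rq int_dist_eq_0_iff)
    then have "(angle (q k) - 1 / ?r) - (angle (q (Suc k)) - 1 / ?s) \<in> \<int>"
      by (simp add: twisted_angle_def rq)
    then have "- ((angle (q k) - 1 / ?r) - (angle (q (Suc k)) - 1 / ?s)) \<in> \<int>"
      by (rule Ints_minus)
    then show ?thesis unfolding r by (simp add: algebra_simps add_divide_distrib)
  qed
  have angle_q: "angle (q k) - angle (q 0) - real k / 2 \<in> \<int>" for k
  proof (induction k)
    case (Suc k)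
    show ?case using Ints_add[OF Suc step[of k]] by (simp add: algebra_simps add_divide_distrib)
  qed simp
  have on_ray_iff: "q k = (\<lambda>i. r k * q 0 i) \<longleftrightarrow> even k" for k
  proof
    assume "q k = (\<lambda>i. r k * q 0 i)"
    then have "angle (q k) = angle (q 0)" using angle_scale[OF r(1)[of k], of "q 0"] by simp
    then have "real k / 2 \<in> \<int>" using Ints_minus[OF angle_q[of k]] by simp
    then obtain m where "real k / 2 = of_int m" by (auto elim: Ints_cases)
    then have "int k = 2 * m" by linarith
    then show "even k" by presburger
  next
    assume "even k"
    then obtain m where "k = 2 * m" by (auto elim: evenE)
    then have "angle (q k) - angle (q 0) \<in> \<int>" using Ints_add[OF angle_q[of k], of "real m"] by simp
    moreover have "r 0 = 1" by (simp add: r_def)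
    ultimately show "q k = (\<lambda>i. r k * q 0 i)"
      using q[of k] q[of 0] r(1)[of k]
      by (intro polar_coordinates_unique)
        (simp_all add: angle_scale radius_scale rq disc_def topspace_Euclidean_space)
  qed
  define v where "v = vec_append 2 e (q 0)"
  let ?G = "{vec_append 2 x (f x) | x. x \<in> disc}"
  have v: "v \<in> topspace (Euclidean_space (2 + 2))"
    unfolding v_def using q[of 0] by (intro vec_append_in_Euclidean_space) (simp add: disc_def)
  have mem_iff: "(\<lambda>i. r k * v i) \<in> ?G \<longleftrightarrow> even k" for k
  proof -
    have split: "(\<lambda>i. r k * v i) = vec_append 2 (p k) (\<lambda>i. r k * q 0 i)"
      by (auto simp: v_def vec_append_def p_def)
    have "(\<lambda>i. r k * v i) \<in> ?G \<longleftrightarrow> q k = (\<lambda>i. r k * q 0 i)"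
    proof
      assume "(\<lambda>i. r k * v i) \<in> ?G"
      then obtain x where x: "x \<in> disc"
        and eq: "vec_append 2 (p k) (\<lambda>i. r k * q 0 i) = vec_append 2 x (f x)"
        unfolding split by blast
      have "p k = x \<and> (\<lambda>i. r k * q 0 i) = f x"
        using vec_append_inject[OF eq] p[of k] x by (simp add: disc_def)
      then show "q k = (\<lambda>i. r k * q 0 i)" unfolding q_def[of k] by simp
    next
      assume "q k = (\<lambda>i. r k * q 0 i)"
      then have "(\<lambda>i. r k * v i) = vec_append 2 (p k) (f (p k))"
        unfolding split q_def[of k] by simp
      then show "(\<lambda>i. r k * v i) \<in> ?G" using p[of k] by blast
    qed
    then show ?thesis using on_ray_iff by simp
  qed
  have "r \<longlonglongrightarrow> 0" unfolding r_def by real_asymp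
  then have lim: "filterlim r (at_right 0) sequentially"
    using r(1) by (intro tendsto_imp_filterlim_at_right) simp_all
  have "(\<forall>\<^sub>F s in at_right 0. (\<lambda>i. s * v i) \<in> ?G) \<or> (\<forall>\<^sub>F s in at_right 0. (\<lambda>i. s * v i) \<notin> ?G)"
    using semialgebraic_on_ray[OF _ v] sa unfolding semialgebraic_map_def by blast
  then have "(\<forall>\<^sub>F k in sequentially. even k) \<or> (\<forall>\<^sub>F k in sequentially. odd k)"
  proof (elim disjE)
    assume "\<forall>\<^sub>F s in at_right 0. (\<lambda>i. s * v i) \<in> ?G"
    from eventually_compose_filterlim[OF this lim] show ?thesis unfolding mem_iff by (rule disjI1)
  next
    assume "\<forall>\<^sub>F s in at_right 0. (\<lambda>i. s * v i) \<notin> ?G"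
    from eventually_compose_filterlim[OF this lim] show ?thesis unfolding mem_iff by (rule disjI2)
  qed
  then show False
    unfolding eventually_sequentially by (meson even_Suc le_SucI order_refl)
qed

theorem theorem2:
  shows "\<exists>n m X dX Y dY.
    compact_semialgebraic_metric_space n X dX \<and>
    compact_semialgebraic_metric_space m Y dY \<and>
    (\<exists>f. isometry_onto X dX Y dY f) \<and>
    \<not> (\<exists>f. isometry_onto X dX Y dY f \<and> semialgebraic_map n m X f)"
  using compact_semialgebraic_disc[of 0] compact_semialgebraic_disc[of 1] isometry_twist
    not_semialgebraic_isometry
  by (intro exI[of _ 2] exI[of _ disc] exI[of _ "twisted_dist 0"] exI[of _ "twisted_dist 1"]) auto

end
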